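(* Let $r\ge1$, let $\theta_r=\alpha_1+\cdots+\alpha_r$ be the highest root of $\mathfrak{sl}_{r+1}(\mathbb{C})$, let $I\subseteq[r]$ be nonempty with interval partition $I=\bigsqcup_{x=1}^{n(I)}[i_x,j_x]$, and write $I^c=[r]\setminus I$. For an interval $J$ of consecutive integers which is one of the maximal intervals of $I^c$, let $S(J)$ be the set of all (possibly empty) sets $\mathcal{J}$ of pairwise nonconsecutive integers in $J$ such that $\sigma_{\mathcal{J}}:=\prod_{i\in\mathcal{J}}s_i$ lies in $\mathcal{A}_r(\theta_r,\alpha_I)$. Then: \begin{itemize} \item If $1\notin I$ (so $[1,i_1-1]$ is a maximal interval of $I^c$), then \[\sum_{\mathcal{J}\in S([1,i_1-1])}(-1)^{\ell(\sigma_{\mathcal{J}})}\wp_q\Big(\alpha_{1,i_1-1}-\sum_{i\in\mathcal{J}}\alpha_i\Big)=m_q(\theta_{i_1},\alpha_{i_1}),\] where the right-hand side is computed in $\mathfrak{sl}_{i_1+1}(\mathbb{C})$. \item For each $x\in[n(I)-1]$, with $N=i_{x+1}-j_x+1$, \[\sum_{\mathcal{J}\in S([j_x+1,i_{x+1}-1])}(-1)^{\ell(\sigma_{\mathcal{J}})}\wp_q\Big(\alpha_{j_x+1,i_{x+1}-1}-\sum_{i\in\mathcal{J}}\alpha_i\Big)=m_q(\theta_N,\alpha_1+\alpha_N),\] where the right-hand side is computed in $\mathfrak{sl}_{N+1}(\mathbb{C})$. \item If $r\notin I$ (so $[j_{n(I)}+1,r]$ is a maximal interval of $I^c$), then with $N=r-j_{n(I)}+1$,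 \[\sum_{\mathcal{J}\in S([j_{n(I)}+1,r])}(-1)^{\ell(\sigma_{\mathcal{J}})}\wp_q\Big(\alpha_{j_{n(I)}+1,r}-\sum_{i\in\mathcal{J}}\alpha_i\Big)=m_q(\theta_N,\alpha_1),\] where the right-hand side is computed in $\mathfrak{sl}_{N+1}(\mathbb{C})$. \end{itemize}
   Context: Notation: $[n]=\{1,\dots,n\}$, $[a,b]=\{a,\dots,b\}$. For each rank $N\ge1$, in $\mathfrak{sl}_{N+1}(\mathbb{C})$ the simple roots are $\alpha_i=e_i-e_{i+1}$ ($i\in[N]$), the positive roots are $\alpha_{i,j}=\alpha_i+\cdots+\alpha_j$ ($1\le i\le j\le N$), the highest root is $\theta_N=\alpha_{1,N}$, and $\rho_N$ is half the sum of the positive roots; the Weyl group $W\cong\mathfrak{S}_{N+1}$ is generated by simple reflections $s_i$, with length function $\ell$. Kostant's partition function $\wp(\xi)$ counts ways to write $\xi$ as a nonnegative integral sum of positive roots; its $q$-analog is $\wp_q(\xi)=\sum_{k\ge0}c_kq^k$ with $c_k$ the number of ways to write $\xi$ as a sum of exactly $k$ positive roots (unordered, repetition allowed). The Weyl alternation set in rank $N$ is $\mathcal{A}_N(\lambda,\mu)=\{\sigma\in W:\wp(\sigma(\lambda+\rho_N)-\rho_N-\mu)>0\}$, and $m_q(\lambda,\mu)=\sum_{\sigma\in W}(-1)^{\ell(\sigma)}\wp_q(\sigma(\lambda+\rho_N)-\rho_N-\mu)$. For $I\subseteq[r]$, $\alpha_I=\sum_{i\in I}\alpha_i$; the interval partition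 of $I$ is its decomposition into maximal intervals of consecutive integers $[i_1,j_1]\sqcup\cdots\sqcup[i_{n(I)},j_{n(I)}]$ with $j_x+1<i_{x+1}$. The empty product $\prod_{i\in\emptyset}s_i$ is $1$ and the empty sum of roots is $0$. *)

theory Defs
  imports
    Complex_Main
    "HOL-Library.Function_Algebras"
    "HOL-Library.Multiset"
    "HOL-Computational_Algebra.Polynomial"
    "HOL-Combinatorics.Permutations"
begin

text \<open>
  Weights of \<open>sl\<^sub>N\<^sub>+\<^sub>1\<close> are coordinate vectors with respect to \<open>e\<^sub>1, \<dots>, e\<^sub>N\<^sub>+\<^sub>1\<close>; a vector of rank \<open>N\<close>
  vanishes outside \<open>{1..N+1}\<close>, so all ranks share one type. Addition and subtraction are
  pointwise.
\<close>

type_synonym weight = "nat \<Rightarrow> real"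

definition unit_vec :: "nat \<Rightarrow> weight" where
  "unit_vec i = (\<lambda>k. if k = i then 1 else 0)"

definition simple_root :: "nat \<Rightarrow> weight" where
  "simple_root i = unit_vec i - unit_vec (i + 1)"

text \<open>\<open>root_sum I\<close> is \<open>\<alpha>\<^sub>I\<close>, and \<open>root_seg i j\<close> is \<open>\<alpha>\<^sub>i\<^sub>,\<^sub>j\<close>.\<close>

definition root_sum :: "nat set \<Rightarrow> weight" where
  "root_sum I = (\<Sum>i\<in>I. simple_root i)"

definition root_seg :: "nat \<Rightarrow> nat \<Rightarrow> weight" where
  "root_seg i j = (\<Sum>k=i..j. simple_root k)"

definition positive_roots :: "nat \<Rightarrow> weight set" where
  "positive_roots N = {root_seg i j | i j. 1 \<le> i \<and> i \<le> j \<and> j \<le> N}"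

definition highest_root :: "nat \<Rightarrow> weight" where
  "highest_root N = root_seg 1 N"

definition half_sum :: "nat \<Rightarrow> weight" where
  "half_sum N = (\<lambda>k. (\<Sum>\<beta>\<in>positive_roots N. \<beta> k) / 2)"

text \<open>
  The Weyl group is the symmetric group on \<open>{1..N+1}\<close>, acting by \<open>e\<^sub>i \<mapsto> e\<^bsub>\<sigma>(i)\<^esub>\<close>; the simple
  reflection \<open>s\<^sub>i\<close> is the transposition of \<open>i\<close> and \<open>i + 1\<close>, and \<open>apply_adj_transps ws\<close> is the
  product of the \<open>s\<^sub>i\<close> along the word \<open>ws\<close>.
\<close>

definition weyl_group :: "nat \<Rightarrow> (nat \<Rightarrow> nat) set" where
  "weyl_group N = {\<sigma>. \<sigma> permutes {1..N + 1}}"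

definition weyl_act :: "(nat \<Rightarrow> nat) \<Rightarrow> weight \<Rightarrow> weight" where
  "weyl_act \<sigma> v = (\<lambda>k. v (inv \<sigma> k))"

definition weyl_length :: "nat \<Rightarrow> (nat \<Rightarrow> nat) \<Rightarrow> nat" where
  "weyl_length N \<sigma> =
     (LEAST k. \<exists>ws. length ws = k \<and> set ws \<subseteq> {1..N} \<and> apply_adj_transps ws = \<sigma>)"

lemma weyl_act_unit_vec:
  assumes "\<sigma> \<in> weyl_group N"
  shows "weyl_act \<sigma> (unit_vec i) = unit_vec (\<sigma> i)"
  using assms
  by (auto simp: weyl_act_def unit_vec_def weyl_group_def fun_eq_iff permutes_inv_eq)

lemma weyl_act_simple_reflection:
  "weyl_act (apply_adj_transps [i]) v = (\<lambda>k. v k - (v i - v (i + 1)) * simple_root i k)"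
  by (auto simp: weyl_act_def simple_root_def unit_vec_def fun_eq_iff transpose_def)

lemma weyl_group_generated:
  "weyl_group N = {apply_adj_transps ws | ws. set ws \<subseteq> {1..N}}"
proof (intro equalityI subsetI)
  fix \<sigma> assume "\<sigma> \<in> {apply_adj_transps ws | ws. set ws \<subseteq> {1..N}}"
  then obtain ws where "\<sigma> = apply_adj_transps ws" "set ws \<subseteq> {1..N}" by blast
  then show "\<sigma> \<in> weyl_group N"
    by (auto simp: weyl_group_def intro!: permutes_apply_adj_transps)
next
  have app: "apply_adj_transps (us @ ws) = apply_adj_transps us \<circ> apply_adj_transps ws" for us ws
    by (induction us) (auto simp: o_assoc)
  have tr: "\<exists>ws. set ws \<subseteq> {1..N} \<and> apply_adj_transps ws = transpose a b"
    if "a < b" "a \<in> {1..N+1}" "b \<in> {1..N+1}" for a b :: nat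
    using that adj_transp_seq_correct[of a b] set_adj_transp_seq[of a b]
    by (intro exI[of _ "adj_transp_seq a b"]) auto
  have tr': "\<exists>ws. set ws \<subseteq> {1..N} \<and> apply_adj_transps ws = transpose a b"
    if "a \<in> {1..N+1}" "b \<in> {1..N+1}" for a b :: nat
  proof (cases a b rule: linorder_cases)
    case equal
    then show ?thesis by (intro exI[of _ "[]"]) auto
  qed (use tr[of a b] tr[of b a] that in \<open>auto simp: transpose_commute\<close>)
  fix \<sigma> assume "\<sigma> \<in> weyl_group N"
  then have "\<sigma> permutes {1..N+1}" by (simp add: weyl_group_def)
  moreover have "finite {1..N+1}" by simp
  ultimately have "\<exists>ws. set ws \<subseteq> {1..N} \<and> apply_adj_transps ws = \<sigma>"
  proof (induction rule: permutes_induct)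
    case id
    then show ?case by (intro exI[of _ "[]"]) auto
  next
    case (swap a b p)
    obtain us where "set us \<subseteq> {1..N}" "apply_adj_transps us = transpose a b"
      using tr' swap by blast
    moreover obtain ws where "set ws \<subseteq> {1..N}" "apply_adj_transps ws = p"
      using swap by blast
    ultimately show ?case
      by (intro exI[of _ "us @ ws"]) (auto simp: app)
  qed
  then show "\<sigma> \<in> {apply_adj_transps ws | ws. set ws \<subseteq> {1..N}}" by blast
qed

text \<open>
  A partition is a multiset of positive roots. Coefficient \<open>k\<close> of \<open>kostant_q N \<xi>\<close> is the number
  of partitions of \<open>\<xi>\<close> into exactly \<open>k\<close> roots; there are only finitely many partitions, so neither
  the cardinalities nor the sum over \<open>k\<close> degenerate.
\<close>

definition kostant_partitions :: "nat \<Rightarrow> weight \<Rightarrow> weight multiset set" where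
  "kostant_partitions N \<xi> = {M. set_mset M \<subseteq> positive_roots N \<and> sum_mset M = \<xi>}"

definition kostant :: "nat \<Rightarrow> weight \<Rightarrow> nat" where
  "kostant N \<xi> = card (kostant_partitions N \<xi>)"

definition kostant_coeff :: "nat \<Rightarrow> weight \<Rightarrow> nat \<Rightarrow> nat" where
  "kostant_coeff N \<xi> k = card {M \<in> kostant_partitions N \<xi>. size M = k}"

definition kostant_q :: "nat \<Rightarrow> weight \<Rightarrow> int poly" where
  "kostant_q N \<xi> = (\<Sum>k | kostant_coeff N \<xi> k \<noteq> 0. monom (int (kostant_coeff N \<xi> k)) k)"

lemma root_seg_eq: "i \<le> j \<Longrightarrow> root_seg i j = unit_vec i - unit_vec (j + 1)"
proof (induction j rule: dec_induct)
  case base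
  then show ?case by (simp add: root_seg_def simple_root_def)
next
  case (step j)
  then show ?case by (simp add: root_seg_def simple_root_def)
qed

lemma finite_positive_roots: "finite (positive_roots N)"
proof -
  have "positive_roots N \<subseteq> (\<lambda>(i, j). root_seg i j) ` ({1..N} \<times> {1..N})"
    by (auto simp: positive_roots_def)
  then show ?thesis by (rule finite_subset) auto
qed

lemma finite_kostant_partitions: "finite (kostant_partitions N \<xi>)"
proof -
  define h :: "weight \<Rightarrow> real" where "h v = - (\<Sum>k=1..N+1. real k * v k)" for v
  have h_unit: "h (unit_vec i) = - real i" if "i \<in> {1..N+1}" for i
    using that by (simp add: h_def unit_vec_def if_distrib sum.delta cong: if_cong)
  have h_diff: "h (v - w) = h v - h w" for v w
    by (simp add: h_def algebra_simps sum_subtractf)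
  have h_add: "h (v + w) = h v + h w" for v w
    by (simp add: h_def algebra_simps sum.distrib)
  have h_root: "1 \<le> h \<beta>" if "\<beta> \<in> positive_roots N" for \<beta>
    using that by (auto simp: positive_roots_def root_seg_eq h_diff h_unit)
  have size_le: "real (size M) \<le> h (sum_mset M)" if "set_mset M \<subseteq> positive_roots N" for M
    using that
  proof (induction M)
    case empty
    then show ?case by (simp add: h_def)
  next
    case (add \<beta> M)
    have "h (\<Sum>\<^sub># (add_mset \<beta> M)) = h \<beta> + h (\<Sum>\<^sub># M)"
      by (simp only: sum_mset.add_mset h_add)
    moreover have "1 \<le> h \<beta>" using add.prems by (intro h_root) auto
    moreover have "real (size M) \<le> h (\<Sum>\<^sub># M)" using add by simp
    ultimately show ?case by (simp only: size_add_mset of_nat_Suc)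
  qed
  have "kostant_partitions N \<xi> \<subseteq> (\<Union>n\<le>nat \<lfloor>h \<xi>\<rfloor>. multisets_of_size (positive_roots N) n)"
  proof
    fix M assume "M \<in> kostant_partitions N \<xi>"
    then have *: "set_mset M \<subseteq> positive_roots N" "sum_mset M = \<xi>"
      by (auto simp: kostant_partitions_def)
    from size_le[OF *(1)] * have "size M \<le> nat \<lfloor>h \<xi>\<rfloor>" by (simp add: le_nat_floor)
    with * show "M \<in> (\<Union>n\<le>nat \<lfloor>h \<xi>\<rfloor>. multisets_of_size (positive_roots N) n)"
      by (auto simp: multisets_of_size_def)
  qed
  then show ?thesis
    by (rule finite_subset) (auto intro!: finite_multisets_of_size finite_positive_roots)
qed

lemma coeff_kostant_q: "coeff (kostant_q N \<xi>) k = int (kostant_coeff N \<xi> k)"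
proof -
  have "{k. kostant_coeff N \<xi> k \<noteq> 0} \<subseteq> size ` kostant_partitions N \<xi>"
  proof
    fix k assume "k \<in> {k. kostant_coeff N \<xi> k \<noteq> 0}"
    then have "{M \<in> kostant_partitions N \<xi>. size M = k} \<noteq> {}"
      by (intro notI) (simp add: kostant_coeff_def)
    then show "k \<in> size ` kostant_partitions N \<xi>" by blast
  qed
  then have "finite {k. kostant_coeff N \<xi> k \<noteq> 0}"
    by (rule finite_subset) (simp add: finite_kostant_partitions)
  then show ?thesis
    by (auto simp: kostant_q_def coeff_sum sum.delta)
qed

definition alternation_set :: "nat \<Rightarrow> weight \<Rightarrow> weight \<Rightarrow> (nat \<Rightarrow> nat) set" where
  "alternation_set N \<nu> \<mu> =
     {\<sigma> \<in> weyl_group N. kostant N (weyl_act \<sigma> (\<nu> + half_sum N) - half_sum N - \<mu>) > 0}"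

definition mult_q :: "nat \<Rightarrow> weight \<Rightarrow> weight \<Rightarrow> int poly" where
  "mult_q N \<nu> \<mu> =
     (\<Sum>\<sigma>\<in>weyl_group N. (-1) ^ weyl_length N \<sigma> *
        kostant_q N (weyl_act \<sigma> (\<nu> + half_sum N) - half_sum N - \<mu>))"

definition interval_partition :: "nat set \<Rightarrow> nat \<Rightarrow> (nat \<Rightarrow> nat) \<Rightarrow> (nat \<Rightarrow> nat) \<Rightarrow> bool" where
  "interval_partition I n i j \<longleftrightarrow>
     I = (\<Union>x\<in>{1..n}. {i x..j x}) \<and>
     (\<forall>x\<in>{1..n}. i x \<le> j x) \<and>
     (\<forall>x\<in>{1..<n}. j x + 1 < i (x + 1))"

definition nonconsecutive :: "nat set \<Rightarrow> bool" where
  "nonconsecutive A \<longleftrightarrow> (\<forall>a\<in>A. a + 1 \<notin> A)"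

text \<open>
  The product of the \<open>s\<^sub>i\<close> with \<open>i \<in> A\<close>, taken in increasing order; the factors commute when \<open>A\<close>
  is nonconsecutive.
\<close>

definition reflection_prod :: "nat set \<Rightarrow> nat \<Rightarrow> nat" where
  "reflection_prod A = apply_adj_transps (sorted_list_of_set A)"

definition admissible_sets :: "nat \<Rightarrow> nat set \<Rightarrow> nat set \<Rightarrow> nat set set" where
  "admissible_sets r I J =
     {A. A \<subseteq> J \<and> nonconsecutive A \<and>
         reflection_prod A \<in> alternation_set r (highest_root r) (root_sum I)}"

end

theory Submission
  imports Defs
begin

text \<open>
  An element \<open>\<sigma>\<close> lies in the alternation set of \<open>(\<theta>\<^sub>N, \<alpha>\<^sub>I)\<close> only if every partial coordinate sum
  (the coefficient of some \<open>\<alpha>\<^sub>k\<close>) of \<open>\<sigma>(\<theta>\<^sub>N + \<rho>) - \<rho> - \<alpha>\<^sub>I\<close> is nonnegative. For \<open>\<sigma> = 1\<close> these sums are at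
  most \<open>1\<close>, so \<open>\<sigma>\<^sup>-\<^sup>1\<close> maps each \<open>{1..k}\<close> to itself or, if \<open>2 \<le> k < N\<close> and \<open>k \<notin> I\<close>, to
  \<open>{1..k-1} \<union> {k+1}\<close>. Hence \<open>\<sigma>\<close> is a product of \<open>s\<^sub>k\<close> over a nonconsecutive set \<open>A \<subseteq> {2..<N} - I\<close>;
  all these occur, and they contribute \<open>(-1)\<^bsup>|A|\<^esup> \<wp>\<^sub>q(\<alpha>\<^bsub>[N]-I-A\<^esub>)\<close>. A gap of \<open>I\<close> therefore gives the
  same sum as a smaller rank, because \<open>\<wp>\<^sub>q(\<alpha>\<^sub>B)\<close> is invariant under translating \<open>B\<close> and changing the
  rank.
\<close>

subsection \<open>Coefficients with respect to the simple roots\<close>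

text \<open>For a combination of roots \<open>simple_root i\<close> with i \<ge> 1 this is the
  coefficient of \<open>simple_root k\<close>: the coordinates of e_i - e_{i+1} up to k sum to 1 if
  i = k and to 0 otherwise.\<close>

definition root_coeff :: "nat \<Rightarrow> weight \<Rightarrow> real" where
  "root_coeff k v = (\<Sum>m=1..k. v m)"

lemma root_coeff_add: "root_coeff k (v + w) = root_coeff k v + root_coeff k w"
  by (simp add: root_coeff_def sum.distrib)

lemma root_coeff_diff: "root_coeff k (v - w) = root_coeff k v - root_coeff k w"
  by (simp add: root_coeff_def sum_subtractf)

lemma root_coeff_zero: "root_coeff k 0 = 0"
  by (simp add: root_coeff_def)

lemma root_coeff_unit_vec: "root_coeff k (unit_vec i) = of_bool (1 \<le> i \<and> i \<le> k)"
  by (simp add: root_coeff_def unit_vec_def)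

lemma root_coeff_root_seg:
  assumes "1 \<le> i" "i \<le> j"
  shows "root_coeff k (root_seg i j) = of_bool (i \<le> k \<and> k \<le> j)"
  using assms by (auto simp: root_seg_eq root_coeff_diff root_coeff_unit_vec)

text \<open>\<open>simple_root 0\<close> is kept out of \<open>B\<close>: its -1 at coordinate 1
  would enter every nonempty prefix sum, while its +1 at coordinate 0 is not counted.\<close>

lemma root_coeff_root_sum:
  assumes "0 \<notin> B" "finite B"
  shows "root_coeff k (root_sum B) = of_bool (k \<in> B)"
  using assms(2,1)
proof (induction B rule: finite_induct)
  case empty
  then show ?case by (simp add: root_sum_def root_coeff_zero del: zero_fun_apply)
next
  case (insert b B)
  then have "root_coeff k (simple_root b) = of_bool (k = b)"
    by (auto simp: simple_root_def root_coeff_diff root_coeff_unit_vec)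
  with insert show ?case
    by (auto simp: root_sum_def root_coeff_add simp del: plus_fun_apply)
qed

lemma root_coeff_positive_root:
  "\<beta> \<in> positive_roots N \<Longrightarrow> 0 \<le> root_coeff k \<beta>"
  by (auto simp: positive_roots_def root_coeff_root_seg)

lemma root_coeff_sum_mset_nonneg:
  "set_mset M \<subseteq> positive_roots N \<Longrightarrow> 0 \<le> root_coeff k (sum_mset M)"
proof (induction M)
  case (add \<beta> M)
  then show ?case
    using root_coeff_positive_root[of \<beta> N k] by (simp add: root_coeff_add del: plus_fun_apply)
qed (simp add: root_coeff_zero del: zero_fun_apply)

text \<open>The other parts have nonnegative coefficients, so nothing cancels. Hence a part can only
  involve simple roots that occur in the partitioned weight.\<close>

lemma root_coeff_le_sum_mset:
  assumes "set_mset M \<subseteq> positive_roots N" "\<beta> \<in># M"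
  shows "root_coeff k \<beta> \<le> root_coeff k (sum_mset M)"
proof -
  have "root_coeff k (sum_mset M) = root_coeff k \<beta> + root_coeff k (sum_mset (M - {#\<beta>#}))"
    using assms(2) by (metis insert_DiffM root_coeff_add sum_mset.add_mset)
  moreover have "0 \<le> root_coeff k (sum_mset (M - {#\<beta>#}))"
    using assms(1) by (intro root_coeff_sum_mset_nonneg[of _ N]) (auto dest: in_diffD)
  ultimately show ?thesis by simp
qed

lemma root_seg_eq_root_sum: "root_seg a b = root_sum {a..b}"
  by (simp add: root_seg_def root_sum_def)

lemma root_sum_Diff:
  "finite B \<Longrightarrow> A \<subseteq> B \<Longrightarrow> root_sum (B - A) = root_sum B - root_sum A"
  by (simp add: root_sum_def sum_diff)

lemma simple_root_positive: "i \<in> {1..N} \<Longrightarrow> simple_root i \<in> positive_roots N"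
  by (auto simp: positive_roots_def root_seg_def intro!: exI[of _ i])

subsection \<open>Kostant's partition function\<close>

text \<open>The simple roots indexed by \<open>B\<close> form a partition themselves.\<close>

lemma kostant_root_sum_pos:
  assumes "B \<subseteq> {1..N}"
  shows "0 < kostant N (root_sum B)"
proof -
  have "finite B" using assms finite_subset by blast
  then have "image_mset simple_root (mset_set B) \<in> kostant_partitions N (root_sum B)"
    using assms simple_root_positive
    by (auto simp: kostant_partitions_def root_sum_def sum_unfold_sum_mset)
  then show ?thesis
    by (auto simp: kostant_def card_gt_0_iff finite_kostant_partitions)
qed

text \<open>Positive roots have nonnegative coefficients. This is the obstruction that later
  excludes Weyl group elements from the alternation set.\<close>

lemma kostant_pos_root_coeff:
  assumes "0 < kostant N \<xi>"
  shows "0 \<le> root_coeff k \<xi>"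
proof -
  from assms obtain M where "M \<in> kostant_partitions N \<xi>"
    by (auto simp: kostant_def card_gt_0_iff)
  then show ?thesis
    using root_coeff_sum_mset_nonneg by (auto simp: kostant_partitions_def)
qed

lemma kostant_q_eq_0:
  assumes "kostant N \<xi> = 0"
  shows "kostant_q N \<xi> = 0"
proof -
  have "kostant_partitions N \<xi> = {}"
    using assms by (simp add: kostant_def finite_kostant_partitions)
  then show ?thesis by (simp add: kostant_q_def kostant_coeff_def)
qed

section \<open>Translation of partitions between ranks\<close>

definition shift_weight :: "nat \<Rightarrow> weight \<Rightarrow> weight" where
  "shift_weight d v = (\<lambda>k. if d \<le> k then v (k - d) else 0)"

lemma inj_shift_weight: "inj (shift_weight d)"
proof (rule injI, rule ext)
  fix v w k assume "shift_weight d v = shift_weight d w"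
  from fun_cong[OF this, of "k + d"] show "v k = w k"
    by (simp add: shift_weight_def)
qed

lemma shift_weight_add: "shift_weight d (v + w) = shift_weight d v + shift_weight d w"
  by (auto simp: shift_weight_def fun_eq_iff)

lemma shift_weight_zero: "shift_weight d 0 = 0"
  by (auto simp: shift_weight_def fun_eq_iff)

lemma shift_weight_sum: "shift_weight d (\<Sum>a\<in>A. f a) = (\<Sum>a\<in>A. shift_weight d (f a))"
  by (induction A rule: infinite_finite_induct) (simp_all add: shift_weight_zero shift_weight_add del: plus_fun_apply zero_fun_apply)

lemma shift_weight_sum_mset:
  "shift_weight d (sum_mset M) = sum_mset (image_mset (shift_weight d) M)"
  by (induction M) (simp_all add: shift_weight_zero shift_weight_add del: plus_fun_apply zero_fun_apply)

lemma shift_weight_simple_root: "shift_weight d (simple_root i) = simple_root (i + d)"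
  by (auto simp: shift_weight_def simple_root_def unit_vec_def fun_eq_iff)

lemma shift_weight_root_sum:
  "shift_weight d (root_sum B) = root_sum ((\<lambda>b. b + d) ` B)"
  by (simp add: root_sum_def shift_weight_sum shift_weight_simple_root sum.reindex)

lemma shift_weight_root_seg: "shift_weight d (root_seg i j) = root_seg (i + d) (j + d)"
  by (simp add: root_seg_eq_root_sum shift_weight_root_sum)

text \<open>A partition of a weight supported on a block of simple roots uses only roots inside that
  block, and these are exactly the translates of the rank \<open>N\<close> roots. The bound on
  \<open>N + d\<close> makes all translates roots of rank \<open>r\<close>.\<close>

lemma kostant_partitions_shift:
  assumes B: "B \<subseteq> {1..N}" and le: "N + d \<le> r"
  shows "kostant_partitions r (root_sum ((\<lambda>b. b + d) ` B)) =
    image_mset (shift_weight d) ` kostant_partitions N (root_sum B)"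
proof (intro equalityI subsetI)
  fix M assume "M \<in> kostant_partitions r (root_sum ((\<lambda>b. b + d) ` B))"
  then have M: "set_mset M \<subseteq> positive_roots r" "sum_mset M = root_sum ((\<lambda>b. b + d) ` B)"
    by (auto simp: kostant_partitions_def)
  have finB: "finite B" using B finite_subset by blast
  \<comment> \<open>The partitioned weight has coefficient 0 outside the translated block, so no
    part has a positive coefficient there.\<close>
  have supp: "k \<in> {1 + d..N + d}" if "\<beta> \<in># M" "0 < root_coeff k \<beta>" for \<beta> k
  proof -
    have "0 < root_coeff k (root_sum ((\<lambda>b. b + d) ` B))"
      using root_coeff_le_sum_mset[OF M(1) that(1), of k] that(2) M(2) by simp
    also have "\<dots> = of_bool (k \<in> (\<lambda>b. b + d) ` B)"
      using B finB by (intro root_coeff_root_sum) auto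
    finally show ?thesis using B by (auto split: if_splits)
  qed
  have sub: "set_mset M \<subseteq> shift_weight d ` positive_roots N"
  proof
    fix \<beta> assume "\<beta> \<in># M"
    with M(1) obtain i j where ij: "\<beta> = root_seg i j" "1 \<le> i" "i \<le> j" "j \<le> r"
      by (auto simp: positive_roots_def)
    then have "0 < root_coeff i \<beta>" "0 < root_coeff j \<beta>"
      by (auto simp: root_coeff_root_seg)
    with \<open>\<beta> \<in># M\<close> have "i \<in> {1 + d..N + d}" "j \<in> {1 + d..N + d}"
      by (blast intro: supp)+
    \<comment> \<open>Both endpoints of the root exceed d, so the subtractions do not
      truncate.\<close>
    then have "\<beta> = shift_weight d (root_seg (i - d) (j - d))"
        "root_seg (i - d) (j - d) \<in> positive_roots N"
      using ij by (fastforce simp: shift_weight_root_seg positive_roots_def)+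
    then show "\<beta> \<in> shift_weight d ` positive_roots N" by blast
  qed
  define M' where "M' = image_mset (inv (shift_weight d)) M"
  have "image_mset (shift_weight d) M' = image_mset id M"
    unfolding M'_def multiset.map_comp
    using sub by (intro image_mset_cong) (auto simp: f_inv_into_f inj_shift_weight)
  then have MM': "M = image_mset (shift_weight d) M'" by simp
  have "set_mset M' \<subseteq> positive_roots N"
    using sub by (auto simp: M'_def inj_shift_weight)
  moreover have "shift_weight d (sum_mset M') = shift_weight d (root_sum B)"
    using M(2) MM' by (simp add: shift_weight_sum_mset shift_weight_root_sum)
  then have "sum_mset M' = root_sum B"
    using inj_shift_weight by (auto dest: injD)
  ultimately show "M \<in> image_mset (shift_weight d) ` kostant_partitions N (root_sum B)"
    using MM' by (auto simp: kostant_partitions_def)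
next
  fix M assume "M \<in> image_mset (shift_weight d) ` kostant_partitions N (root_sum B)"
  then obtain M' where M': "M = image_mset (shift_weight d) M'"
      "set_mset M' \<subseteq> positive_roots N" "sum_mset M' = root_sum B"
    by (auto simp: kostant_partitions_def)
  have "shift_weight d \<beta> \<in> positive_roots r" if "\<beta> \<in> positive_roots N" for \<beta>
  proof -
    from that obtain i j where "\<beta> = root_seg i j" "1 \<le> i" "i \<le> j" "j \<le> N"
      by (auto simp: positive_roots_def)
    then show ?thesis
      using le by (fastforce simp: shift_weight_root_seg positive_roots_def)
  qed
  then show "M \<in> kostant_partitions r (root_sum ((\<lambda>b. b + d) ` B))"
    using M' by (auto simp: kostant_partitions_def shift_weight_sum_mset[symmetric] shift_weight_root_sum)
qed

text \<open>Translating every part is injective on multisets and keeps the number of parts, so the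
  polynomials agree coefficient by coefficient.\<close>

lemma kostant_q_shift:
  assumes "B \<subseteq> {1..N}" "N + d \<le> r"
  shows "kostant_q r (root_sum ((\<lambda>b. b + d) ` B)) = kostant_q N (root_sum B)"
proof -
  have "kostant_coeff r (root_sum ((\<lambda>b. b + d) ` B)) k = kostant_coeff N (root_sum B) k" for k
  proof -
    have "{M \<in> kostant_partitions r (root_sum ((\<lambda>b. b + d) ` B)). size M = k} =
        image_mset (shift_weight d) ` {M \<in> kostant_partitions N (root_sum B). size M = k}"
      unfolding kostant_partitions_shift[OF assms] by auto
    moreover have "inj_on (image_mset (shift_weight d))
        {M \<in> kostant_partitions N (root_sum B). size M = k}"
      using multiset.inj_map[OF inj_shift_weight] by (rule inj_on_subset) simp
    ultimately show ?thesis
      unfolding kostant_coeff_def by (simp only: card_image)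
  qed
  then show ?thesis by (simp add: kostant_q_def)
qed

subsection \<open>Products of commuting simple reflections\<close>

text \<open>The factors are transpositions with disjoint supports, so each point is moved by at most
  one of them and the order of the word does not matter.\<close>

lemma apply_adj_transps_nonconsecutive:
  assumes "distinct xs" "nonconsecutive (set xs)"
  shows "apply_adj_transps xs k =
    (if k \<in> set xs then k + 1 else if 1 \<le> k \<and> k - 1 \<in> set xs then k - 1 else k)"
  using assms
proof (induction xs)
  case (Cons x xs)
  then have nc: "nonconsecutive (set xs)" by (auto simp: nonconsecutive_def)
  have *: "x \<notin> set xs" "x + 1 \<notin> set xs" "\<And>y. y \<in> set xs \<Longrightarrow> y + 1 \<noteq> x"
      "\<And>y. y \<in> set xs \<Longrightarrow> y + 1 \<notin> set xs"
    using Cons.prems by (auto simp: nonconsecutive_def)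
  have **: "\<not> (1 \<le> x \<and> x - 1 \<in> set xs)"
    using *(3)[of "x - 1"] by auto
  have IH: "apply_adj_transps xs k =
      (if k \<in> set xs then k + 1 else if 1 \<le> k \<and> k - 1 \<in> set xs then k - 1 else k)"
    using Cons nc by simp
  \<comment> \<open>The tail \<open>xs\<close> acts first. It fixes x and x + 1, hence maps no other
    point there, and the leading transposition affects only these two.\<close>
  consider "k = x" | "k = x + 1" | "k \<noteq> x" "k \<noteq> x + 1" by blast
  then show ?case
  proof cases
    case 1
    then have "apply_adj_transps xs k = x"
      using * ** IH by auto
    then show ?thesis using 1 by simp
  next
    case 2
    then have "apply_adj_transps xs k = x + 1"
      using * IH by auto
    then show ?thesis using 2 * by simp
  next
    case 3
    then have "apply_adj_transps xs k \<noteq> x" "apply_adj_transps xs k \<noteq> x + 1"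
      using * by (auto simp: IH split: if_splits)
    then show ?thesis using 3 by (auto simp: IH transpose_def)
  qed
qed auto

lemma reflection_prod_apply:
  assumes "finite A" "nonconsecutive A"
  shows "reflection_prod A k =
    (if k \<in> A then k + 1 else if 1 \<le> k \<and> k - 1 \<in> A then k - 1 else k)"
  using assms by (simp add: reflection_prod_def apply_adj_transps_nonconsecutive)

lemma inv_reflection_prod:
  assumes "finite A" "nonconsecutive A"
  shows "inv (reflection_prod A) = reflection_prod A"
proof (rule inv_unique_comp)
  show "reflection_prod A \<circ> reflection_prod A = id"
    using assms by (auto simp: fun_eq_iff reflection_prod_apply nonconsecutive_def)
  then show "reflection_prod A \<circ> reflection_prod A = id" .
qed

lemma inj_on_reflection_prod: "inj_on reflection_prod {A. finite A \<and> nonconsecutive A}"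
proof (rule inj_onI)
  fix A B assume AB: "A \<in> {A. finite A \<and> nonconsecutive A}"
      "B \<in> {A. finite A \<and> nonconsecutive A}" "reflection_prod A = reflection_prod B"
  \<comment> \<open>The index set is recovered as the set of points that the permutation moves
    up.\<close>
  have "C = {k. k < reflection_prod C k}" if "finite C" "nonconsecutive C" for C
    using that by (auto simp: reflection_prod_apply split: if_splits)
  from this[of A] this[of B] AB show "A = B" by simp
qed

lemma reflection_prod_in_weyl_group:
  assumes "A \<subseteq> {1..N}"
  shows "reflection_prod A \<in> weyl_group N"
proof -
  have "finite A" using assms finite_subset by blast
  with assms show ?thesis
    by (auto simp: weyl_group_generated reflection_prod_def intro!: exI[of _ "sorted_list_of_set A"])
qed

lemma sign_apply_adj_transps: "sign (apply_adj_transps xs) = (- 1) ^ length xs"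
proof (induction xs)
  case (Cons x xs)
  have "permutation (apply_adj_transps xs)"
  proof (induction xs)
    case (Cons y ys)
    then show ?case
      by (simp add: permutation_swap_id permutation_compose del: comp_apply)
  qed (simp add: permutation_id del: id_apply)
  then show ?case
    using Cons by (simp add: sign_compose permutation_swap_id sign_swap_id del: comp_apply)
qed (simp add: sign_id del: id_apply)

text \<open>A shortest word exists because the simple reflections generate the group, and every word
  for \<sigma> has the length parity given by the sign.\<close>

lemma minus_one_power_weyl_length:
  assumes "\<sigma> \<in> weyl_group N"
  shows "(- 1 :: int) ^ weyl_length N \<sigma> = sign \<sigma>"
proof -
  obtain ws where "set ws \<subseteq> {1..N}" "apply_adj_transps ws = \<sigma>"
    using assms by (auto simp: weyl_group_generated)
  then have "\<exists>k ws. length ws = k \<and> set ws \<subseteq> {1..N} \<and> apply_adj_transps ws = \<sigma>" by blast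
  then have "\<exists>ws. length ws = weyl_length N \<sigma> \<and> set ws \<subseteq> {1..N} \<and> apply_adj_transps ws = \<sigma>"
    unfolding weyl_length_def by (rule LeastI_ex)
  then show ?thesis using sign_apply_adj_transps by metis
qed

text \<open>Only parity matters, so the word of length \<open>card A\<close> does not have to be
  shown reduced.\<close>

lemma minus_one_power_weyl_length_reflection_prod:
  assumes "A \<subseteq> {1..N}"
  shows "(- 1 :: int poly) ^ weyl_length N (reflection_prod A) = (- 1) ^ card A"
proof -
  have "(- 1 :: int) ^ weyl_length N (reflection_prod A) = (- 1) ^ card A"
    using assms by (simp add: minus_one_power_weyl_length reflection_prod_in_weyl_group)
      (simp add: reflection_prod_def sign_apply_adj_transps)
  \<comment> \<open>A power of -1 depends only on the parity of the exponent, which carries the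
    equation from integers to polynomials.\<close>
  then show ?thesis
    by (metis (mono_tags) minus_one_power_iff one_neq_neg_one)
qed

subsection \<open>The alternation set\<close>

text \<open>The support of the coefficients is the interval, which determines its endpoints. This
  allows sums over the set of positive roots to be indexed by pairs.\<close>

lemma root_seg_inject:
  assumes "1 \<le> i" "i \<le> j" "1 \<le> i'" "i' \<le> j'" "root_seg i j = root_seg i' j'"
  shows "i = i' \<and> j = j'"
proof -
  have "i \<le> k \<and> k \<le> j \<longleftrightarrow> i' \<le> k \<and> k \<le> j'" for k
  proof -
    have "(of_bool (i \<le> k \<and> k \<le> j) :: real) = of_bool (i' \<le> k \<and> k \<le> j')"
      using assms root_coeff_root_seg by metis
    then show ?thesis by (simp only: of_bool_eq_iff)
  qed
  from this[of i] this[of i'] this[of j] this[of j'] assms show ?thesis by auto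
qed

text \<open>For k in \<open>{1..N + 1}\<close>, coordinate k is +1 in the N + 1 - k roots that start
  at k and -1 in the k - 1 roots that end at k - 1; half the difference is N/2 + 1 - k.\<close>

lemma half_sum_apply:
  "half_sum N k = (if k \<in> {1..N + 1} then real N / 2 + 1 - real k else 0)"
proof -
  define P where "P = (SIGMA i:{1..N}. {i..N})"
  have pos: "positive_roots N = (\<lambda>(i, j). root_seg i j) ` P"
    unfolding positive_roots_def P_def by force
  have inj: "inj_on (\<lambda>(i, j). root_seg i j) P"
    by (auto simp: inj_on_def P_def dest!: root_seg_inject[rotated 4])
  have "(\<Sum>\<beta>\<in>positive_roots N. \<beta> k) = (\<Sum>(i, j)\<in>P. root_seg i j k)"
    unfolding pos by (subst sum.reindex[OF inj]) (auto intro!: sum.cong)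
  also have "\<dots> = (\<Sum>i=1..N. \<Sum>j=i..N. root_seg i j k)"
    unfolding P_def by (subst sum.Sigma) auto
  also have "\<dots> = (\<Sum>i=1..N. (real N + 1 - real i) * of_bool (k = i)
      - of_bool (i + 1 \<le> k \<and> k \<le> N + 1))"
  proof (rule sum.cong)
    fix i assume i: "i \<in> {1..N}"
    have "(\<Sum>j=i..N. root_seg i j k) = (\<Sum>j=i..N. of_bool (k = i) - of_bool (j + 1 = k))"
      by (rule sum.cong) (auto simp: root_seg_eq unit_vec_def)
    also have "\<dots> = (real N + 1 - real i) * of_bool (k = i) - (\<Sum>j=i..N. of_bool (j + 1 = k))"
      using i by (auto simp: sum_subtractf of_nat_diff)
    \<comment> \<open>The condition is solved for j so that the sum collapses; the factor
      \<open>of_bool (1 \<le> k)\<close> covers k = 0, where k - 1 truncates to 0.\<close>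
    also have "(\<Sum>j=i..N. of_bool (j + 1 = k) :: real) =
        (\<Sum>j=i..N. if j = k - 1 then of_bool (1 \<le> k) else 0)"
      by (rule sum.cong) auto
    also have "\<dots> = of_bool (i + 1 \<le> k \<and> k \<le> N + 1)"
      using i by (subst sum.delta) auto
    finally show "(\<Sum>j=i..N. root_seg i j k) = (real N + 1 - real i) * of_bool (k = i)
      - of_bool (i + 1 \<le> k \<and> k \<le> N + 1)" .
  qed simp
  also have "\<dots> = (\<Sum>i=1..N. (real N + 1 - real i) * of_bool (k = i))
      - (\<Sum>i=1..N. of_bool (i + 1 \<le> k \<and> k \<le> N + 1))"
    by (rule sum_subtractf)
  also have "(\<Sum>i=1..N. (real N + 1 - real i) * of_bool (k = i)) =
      (\<Sum>i=1..N. if i = k then real N + 1 - real k else 0)"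
    by (rule sum.cong) auto
  also have "\<dots> = of_bool (k \<in> {1..N}) * (real N + 1 - real k)"
    by (subst sum.delta) auto
  also have "(\<Sum>i=1..N. of_bool (i + 1 \<le> k \<and> k \<le> N + 1) :: real) =
      of_bool (k \<in> {1..N + 1}) * (real k - 1)"
  proof (cases "k \<in> {1..N + 1}")
    case True
    then have "(\<Sum>i=1..N. of_bool (i + 1 \<le> k \<and> k \<le> N + 1) :: real) = (\<Sum>i\<in>{1..<k}. 1)"
      by (intro sum.mono_neutral_cong_right) auto
    with True show ?thesis by (simp add: of_nat_diff)
  next
    case False
    then show ?thesis by (intro sum.neutral[THEN trans]) auto
  qed
  finally have eq: "(\<Sum>\<beta>\<in>positive_roots N. \<beta> k) =
      of_bool (k \<in> {1..N}) * (real N + 1 - real k) - of_bool (k \<in> {1..N + 1}) * (real k - 1)" .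
  consider "k \<in> {1..N}" | "k = N + 1" | "k \<notin> {1..N + 1}" by fastforce
  then show ?thesis
    unfolding half_sum_def eq by cases (auto simp: field_simps)
qed

text \<open>
  Up to an additive constant, \<open>theta_rho_rank N\<close> is the negative of the coordinate vector
  \<open>\<theta>\<^sub>N + \<rho>\<^sub>N\<close>, normalised to be natural-valued.
\<close>

definition theta_rho_rank :: "nat \<Rightarrow> nat \<Rightarrow> nat" where
  "theta_rho_rank N m = (if m = 1 then 0 else if m = N + 1 then N + 2 else m)"

text \<open>Adding e_1 - e_{N+1} changes only the two end coordinates: rank 1 drops to 0 and rank N
  + 1 rises to N + 2.\<close>

lemma highest_root_plus_half_sum:
  assumes "1 \<le> N"
  shows "(highest_root N + half_sum N) k =
    (if k \<in> {1..N + 1} then real N / 2 + 1 - real (theta_rho_rank N k) else 0)"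
  using assms
  by (auto simp: highest_root_def root_seg_eq unit_vec_def half_sum_apply theta_rho_rank_def)

text \<open>A prefix with k \<le> N meets only the altered rank at position 1, which is smaller by
  1.\<close>

lemma sum_theta_rho_rank:
  assumes "k \<in> {1..N}"
  shows "(\<Sum>m=1..k. real m) = (\<Sum>m=1..k. real (theta_rho_rank N m)) + 1"
proof -
  have "(\<Sum>m=1..k. real m) = (\<Sum>m=1..k. real (theta_rho_rank N m) + (if m = 1 then 1 else 0))"
    using assms by (intro sum.cong) (auto simp: theta_rho_rank_def)
  also have "\<dots> = (\<Sum>m=1..k. real (theta_rho_rank N m)) + 1"
    using assms by (subst sum.distrib, subst sum.delta) auto
  finally show ?thesis .
qed

text \<open>The constants N/2 + 1 cancel, leaving ranks only. Nonnegativity thus bounds the rank sum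
  over the image of \<open>{1..k}\<close> under the inverse of \<sigma>.\<close>

lemma root_coeff_weyl_act:
  assumes \<sigma>: "\<sigma> \<in> weyl_group N" and I: "I \<subseteq> {1..N}" and k: "k \<in> {1..N}"
  shows "root_coeff k (weyl_act \<sigma> (highest_root N + half_sum N) - half_sum N - root_sum I) =
    (\<Sum>m=1..k. real (theta_rho_rank N m)) + 1 - (\<Sum>m=1..k. real (theta_rho_rank N (inv \<sigma> m)))
    - of_bool (k \<in> I)"
proof -
  have perm: "inv \<sigma> permutes {1..N + 1}"
    using \<sigma> by (simp add: weyl_group_def permutes_inv)
  have "root_coeff k (root_sum I) = of_bool (k \<in> I)"
    using I by (intro root_coeff_root_sum) (auto intro: finite_subset)
  moreover have "root_coeff k (weyl_act \<sigma> (highest_root N + half_sum N) - half_sum N) =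
      (\<Sum>m=1..k. real m - real (theta_rho_rank N (inv \<sigma> m)))"
    unfolding root_coeff_def
  proof (rule sum.cong)
    fix m assume "m \<in> {1..k}"
    with k have m: "m \<in> {1..N + 1}" by auto
    then have "inv \<sigma> m \<in> {1..N + 1}" using permutes_in_image[OF perm] by blast
    with m k show "(weyl_act \<sigma> (highest_root N + half_sum N) - half_sum N) m =
        real m - real (theta_rho_rank N (inv \<sigma> m))"
      by (simp add: weyl_act_def highest_root_plus_half_sum half_sum_apply del: plus_fun_apply)
  qed simp
  ultimately show ?thesis
    by (simp only: root_coeff_diff[of k _ "root_sum I"] sum_subtractf sum_theta_rho_rank[OF k])
qed

text \<open>
  Trading an element of \<open>{1..k}\<close> for a larger one raises the rank sum by at least the gap
  between consecutive ranks, which is \<open>1\<close> except at both ends, where it exceeds \<open>1\<close>.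
\<close>

lemma rank_sum_prefix_cases:
  assumes T: "T \<subseteq> {1..N + 1}" "card T = k" and k: "k \<in> {1..N}"
    and le: "(\<Sum>m\<in>T. theta_rho_rank N m) + of_bool (k \<in> I) \<le> (\<Sum>m=1..k. theta_rho_rank N m) + 1"
  shows "T = {1..k} \<or> T = insert (k + 1) {1..k - 1} \<and> k \<in> {2..<N} - I"
proof -
  let ?g = "theta_rho_rank N"
  \<comment> \<open>\<open>A\<close> collects the elements traded away and \<open>B\<close> those
    received; they are equally many.\<close>
  define A B where "A = {1..k} - T" and "B = T - {1..k}"
  have fin: "finite T" using T(1) finite_subset by blast
  have TB: "T = (T \<inter> {1..k}) \<union> B" and kA: "{1..k} = (T \<inter> {1..k}) \<union> A"
    by (auto simp: A_def B_def)
  have "card T = card (T \<inter> {1..k}) + card B"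
    by (subst TB, rule card_Un_disjoint) (use fin in \<open>auto simp: B_def\<close>)
  moreover have "card {1..k} = card (T \<inter> {1..k}) + card A"
    by (subst kA, rule card_Un_disjoint) (use fin in \<open>auto simp: A_def\<close>)
  ultimately have cAB: "card A = card B" using T(2) by simp
  have "sum ?g T = sum ?g (T \<inter> {1..k}) + sum ?g B"
    by (subst TB, rule sum.union_disjoint) (use fin in \<open>auto simp: B_def\<close>)
  moreover have "sum ?g {1..k} = sum ?g (T \<inter> {1..k}) + sum ?g A"
    by (subst kA, rule sum.union_disjoint) (use fin in \<open>auto simp: A_def\<close>)
  ultimately have sAB: "sum ?g B + of_bool (k \<in> I) \<le> sum ?g A + 1" using le by simp
  \<comment> \<open>Every received rank is at least \<open>?g k + 1\<close> and every lost rank at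
    most \<open>?g k\<close>, so each trade costs at least 1 and at most one trade is
    affordable.\<close>
  have "card B * (?g k + 1) \<le> sum ?g B"
    by (rule sum_bounded_below[of B _ ?g, simplified])
      (use T(1) k in \<open>auto simp: B_def theta_rho_rank_def\<close>)
  moreover have "sum ?g A \<le> card A * ?g k"
    by (rule sum_bounded_above[of A ?g, simplified])
      (use k in \<open>auto simp: A_def theta_rho_rank_def\<close>)
  ultimately have cB: "card B + of_bool (k \<in> I) \<le> 1" using sAB cAB by simp
  show ?thesis
  proof (cases "card B = 0")
    case True
    moreover have "finite A" "finite B" using fin by (auto simp: A_def B_def)
    ultimately have "A = {}" "B = {}" using cAB by auto
    then show ?thesis by (auto simp: A_def B_def)
  next
    case False
    with cB have "card B = 1" "k \<notin> I" by (auto split: if_splits)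
    then obtain a b where ab: "A = {a}" "B = {b}" using cAB by (metis card_1_singletonE)
    have a: "a \<in> {1..k}" "a \<notin> T" and b: "b \<in> T" "b \<notin> {1..k}"
      using ab unfolding A_def B_def by blast+
    have "?g b \<le> ?g a + 1" using sAB ab by simp
    \<comment> \<open>A rank increase of at most 1 forces neighbours, and k = 1 and k = N are ruled
      out because the rank gap there is at least 2.\<close>
    then have eq: "b = k + 1" "a = k" "k \<in> {2..<N}"
      using a b T(1) k by (auto simp: theta_rho_rank_def split: if_splits)
    have "T = ({1..k} - A) \<union> B" by (auto simp: A_def B_def)
    also have "\<dots> = insert (k + 1) {1..k - 1}" using ab eq by auto
    finally show ?thesis using eq \<open>k \<notin> I\<close> by auto
  qed
qed

section \<open>Permutations that almost preserve initial segments\<close>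

text \<open>The images of all initial segments determine \<tau>, since \<tau>(k) is the single point
  by which the images of \<open>{1..k}\<close> and \<open>{1..k - 1}\<close> differ. The set sought
  consists of the k whose segment is not preserved.\<close>

lemma permutation_eq_reflection_prod:
  assumes \<tau>: "\<tau> permutes {1..N + 1}"
    and pre: "\<And>k. k \<in> {1..N} \<Longrightarrow>
      \<tau> ` {1..k} = {1..k} \<or> \<tau> ` {1..k} = insert (k + 1) {1..k - 1} \<and> k \<in> X"
  obtains A where "A \<subseteq> X" "nonconsecutive A" "finite A" "\<tau> = reflection_prod A"
proof
  define A where "A = {k \<in> {1..N}. \<tau> ` {1..k} \<noteq> {1..k}}"
  show "A \<subseteq> X" using pre by (auto simp: A_def)
  show fin: "finite A" by (simp add: A_def)
  have img: "\<tau> ` {1..k} = (if k \<in> A then insert (k + 1) {1..k - 1} else {1..k})"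
    if k: "k \<le> N + 1" for k
  proof -
    consider "k = 0" | "k = N + 1" | "k \<in> {1..N}" using k by fastforce
    then show ?thesis
    proof cases
      case 2
      then show ?thesis using permutes_image[OF \<tau>] by (auto simp: A_def)
    next
      case 3
      then show ?thesis using pre[of k] by (auto simp: A_def)
    qed (simp add: A_def)
  qed
  show nc: "nonconsecutive A"
    unfolding nonconsecutive_def
  proof (intro ballI notI)
    fix a assume a: "a \<in> A" "a + 1 \<in> A"
    have "\<tau> ` {1..a} \<subseteq> \<tau> ` {1..a + 1}" by (intro image_mono) auto
    moreover have "a \<le> N" using a by (auto simp: A_def)
    \<comment> \<open>Images of nested segments are nested, but a + 1 lies in the left set and not
      in the right one.\<close>
    ultimately have "insert (a + 1) {1..a - 1} \<subseteq> insert (a + 1 + 1) {1..a + 1 - 1}"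
      using a img[of a] img[of "a + 1"] by simp
    then show False by auto
  qed
  show "\<tau> = reflection_prod A"
  proof
    fix k
    show "\<tau> k = reflection_prod A k"
    proof (cases "k \<in> {1..N + 1}")
      case False
      then have "k \<notin> A" "\<not> (1 \<le> k \<and> k - 1 \<in> A)" by (auto simp: A_def)
      then show ?thesis
        using permutes_not_in[OF \<tau> False] by (auto simp: reflection_prod_apply[OF fin nc])
    next
      case True
      have "{\<tau> k} = \<tau> ` ({1..k} - {1..k - 1})"
        using True by (auto intro!: arg_cong[of _ _ \<tau>])
      also have "\<dots> = \<tau> ` {1..k} - \<tau> ` {1..k - 1}"
        by (rule image_set_diff) (rule permutes_inj[OF \<tau>])
      finally have eq: "{\<tau> k} = \<tau> ` {1..k} - \<tau> ` {1..k - 1}" .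
      have "k \<le> N + 1" "k - 1 \<le> N + 1" using True by auto
      note img_k = this[THEN img]
      consider "k \<in> A" "k - 1 \<notin> A" | "k \<notin> A" "k - 1 \<in> A" | "k \<notin> A" "k - 1 \<notin> A"
        using nc True by (force simp: nonconsecutive_def)
      then show ?thesis
      proof cases
        case 1
        then have "{\<tau> k} = insert (k + 1) {1..k - 1} - {1..k - 1}"
          using eq img_k by simp
        then have "\<tau> k = k + 1" by auto
        with 1 show ?thesis by (simp add: reflection_prod_apply[OF fin nc])
      next
        case 2
        then have "2 \<le> k" by (auto simp: A_def)
        with 2 have "{\<tau> k} = {1..k} - insert (k - 1 + 1) {1..k - 1 - 1}"
          using eq img_k by simp
        also have "\<dots> = {k - 1}" using \<open>2 \<le> k\<close> by auto
        finally have "\<tau> k = k - 1" by simp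
        with 2 True show ?thesis by (simp add: reflection_prod_apply[OF fin nc])
      next
        case 3
        then have "{\<tau> k} = {1..k} - {1..k - 1}"
          using eq img_k by simp
        also have "\<dots> = {k}" using True by auto
        finally have "\<tau> k = k" by simp
        with 3 show ?thesis by (simp add: reflection_prod_apply[OF fin nc])
      qed
    qed
  qed
qed

section \<open>Reflection products acting on the shifted highest root\<close>

lemma root_sum_apply:
  assumes "finite A"
  shows "root_sum A k = of_bool (k \<in> A) - of_bool (1 \<le> k \<and> k - 1 \<in> A)"
  using assms
proof (induction A rule: finite_induct)
  case empty
  then show ?case by (simp add: root_sum_def)
next
  case (insert a A)
  then show ?case
    by (auto simp: root_sum_def simple_root_def unit_vec_def)
qed

text \<open>For 2 \<le> l < N the coordinates l and l + 1 of \<theta> + \<rho> differ by exactly 1,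
  so s_l subtracts \<alpha>_l; nonconsecutive reflections do not interact.\<close>

lemma weyl_act_reflection_prod:
  assumes A: "A \<subseteq> {2..<N}" "nonconsecutive A"
  shows "weyl_act (reflection_prod A) (highest_root N + half_sum N) - half_sum N =
    highest_root N - root_sum A"
\<comment> \<open>A nonempty \<open>A\<close> guarantees 1 \<le> N, which the coordinate formula
  requires.\<close>
proof (cases "A = {}")
  case True
  then show ?thesis by (simp add: reflection_prod_def weyl_act_def root_sum_def fun_eq_iff
        inv_id[unfolded id_def])
next
  case False
  then have N: "1 \<le> N" using A by fastforce
  have fin: "finite A" using A(1) finite_subset by blast
  note th = highest_root_plus_half_sum[OF N]
  have "(highest_root N + half_sum N) (reflection_prod A k) =
      (highest_root N + half_sum N) k - root_sum A k" for k
  proof -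
    consider "k \<in> A" | "k \<notin> A" "1 \<le> k" "k - 1 \<in> A" | "k \<notin> A" "\<not> (1 \<le> k \<and> k - 1 \<in> A)" by blast
    then show ?thesis
    proof cases
      case 1
      moreover have "\<not> (1 \<le> k \<and> k - 1 \<in> A)"
        using 1 A(2) by (force simp: nonconsecutive_def)
      moreover have "2 \<le> k" "k < N" using 1 A(1) by auto
      ultimately show ?thesis
        by (simp add: th root_sum_apply[OF fin] reflection_prod_apply[OF fin A(2)] theta_rho_rank_def
            del: plus_fun_apply)
    next
      case 2
      moreover from 2 obtain l where l: "k = l + 1" by (metis le_add_diff_inverse2)
      moreover have "2 \<le> l" "l < N" using 2 l A(1) by auto
      ultimately show ?thesis
        by (simp add: th root_sum_apply[OF fin] reflection_prod_apply[OF fin A(2)] theta_rho_rank_def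
            del: plus_fun_apply)
    next
      case 3
      then show ?thesis
        by (auto simp: root_sum_apply[OF fin] reflection_prod_apply[OF fin A(2)])
    qed
  qed
  then show ?thesis
    by (simp add: weyl_act_def inv_reflection_prod[OF fin A(2)] fun_eq_iff)
qed

lemma weyl_act_reflection_prod_root_sum:
  assumes "I \<subseteq> {1..N}" "A \<subseteq> {2..<N} - I" "nonconsecutive A"
  shows "weyl_act (reflection_prod A) (highest_root N + half_sum N) - half_sum N - root_sum I =
    root_sum ({1..N} - I - A)"
proof -
  have "A \<subseteq> {1..N} - I" "A \<subseteq> {2..<N}" using assms by auto
  then show ?thesis
    using assms
    by (simp add: weyl_act_reflection_prod root_sum_Diff del: plus_fun_apply)
      (simp add: highest_root_def root_seg_eq_root_sum)
qed

definition nonconsecutive_subsets :: "nat set \<Rightarrow> nat set set" where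
  "nonconsecutive_subsets X = {A. A \<subseteq> X \<and> nonconsecutive A}"

lemma alternation_set_highest_root:
  assumes I: "I \<subseteq> {1..N}"
  shows "alternation_set N (highest_root N) (root_sum I) =
    reflection_prod ` nonconsecutive_subsets ({2..<N} - I)"
proof (intro equalityI subsetI)
  fix \<sigma> assume "\<sigma> \<in> alternation_set N (highest_root N) (root_sum I)"
  then have \<sigma>: "\<sigma> \<in> weyl_group N"
    and pos: "0 < kostant N (weyl_act \<sigma> (highest_root N + half_sum N) - half_sum N - root_sum I)"
    by (auto simp: alternation_set_def)
  then have perm: "\<sigma> permutes {1..N + 1}" by (simp add: weyl_group_def)
  then have perm': "inv \<sigma> permutes {1..N + 1}" by (rule permutes_inv)
  \<comment> \<open>The inverse appears because \<open>weyl_act\<close> permutes coordinates through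
    it; nonnegative coefficients become the rank bound on each prefix.\<close>
  have pre: "inv \<sigma> ` {1..k} = {1..k} \<or>
      inv \<sigma> ` {1..k} = insert (k + 1) {1..k - 1} \<and> k \<in> {2..<N} - I" if k: "k \<in> {1..N}" for k
  proof (rule rank_sum_prefix_cases[OF _ _ k])
    have inj: "inj_on (inv \<sigma>) {1..k}" using permutes_inj_on[OF perm'] .
    show "inv \<sigma> ` {1..k} \<subseteq> {1..N + 1}"
      using k image_mono[of "{1..k}" "{1..N + 1}" "inv \<sigma>"] permutes_image[OF perm'] by auto
    show "card (inv \<sigma> ` {1..k}) = k" using card_image[OF inj] by simp
    have "0 \<le> (\<Sum>m=1..k. real (theta_rho_rank N m)) + 1
        - (\<Sum>m=1..k. real (theta_rho_rank N (inv \<sigma> m))) - of_bool (k \<in> I)"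
      using kostant_pos_root_coeff[OF pos, of k] root_coeff_weyl_act[OF \<sigma> I k] by simp
    then have "real ((\<Sum>m=1..k. theta_rho_rank N (inv \<sigma> m)) + of_bool (k \<in> I)) \<le>
        real ((\<Sum>m=1..k. theta_rho_rank N m) + 1)" by simp
    then show "sum (theta_rho_rank N) (inv \<sigma> ` {1..k}) + of_bool (k \<in> I) \<le>
        (\<Sum>m=1..k. theta_rho_rank N m) + 1"
      unfolding of_nat_le_iff by (simp only: sum.reindex[OF inj] comp_def)
  qed
  obtain A where A: "A \<subseteq> {2..<N} - I" "nonconsecutive A" "finite A" "inv \<sigma> = reflection_prod A"
    using permutation_eq_reflection_prod[OF perm' pre] by blast
  have "\<sigma> = inv (inv \<sigma>)" using perm by (simp add: permutes_inv_inv)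
  also have "\<dots> = reflection_prod A" using A by (simp add: inv_reflection_prod)
  finally show "\<sigma> \<in> reflection_prod ` nonconsecutive_subsets ({2..<N} - I)"
    using A by (auto simp: nonconsecutive_subsets_def)
next
  fix \<sigma> assume "\<sigma> \<in> reflection_prod ` nonconsecutive_subsets ({2..<N} - I)"
  then obtain A where A: "\<sigma> = reflection_prod A" "A \<subseteq> {2..<N} - I" "nonconsecutive A"
    by (auto simp: nonconsecutive_subsets_def)
  have "A \<subseteq> {1..N}" using A(2) by auto
  moreover have "0 < kostant N (root_sum ({1..N} - I - A))"
    by (rule kostant_root_sum_pos) auto
  ultimately show "\<sigma> \<in> alternation_set N (highest_root N) (root_sum I)"
    using A I by (simp add: alternation_set_def reflection_prod_in_weyl_group
        weyl_act_reflection_prod_root_sum del: plus_fun_apply)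
qed

lemma inj_on_reflection_prod_subsets:
  "finite X \<Longrightarrow> inj_on reflection_prod (nonconsecutive_subsets X)"
  by (rule inj_on_subset[OF inj_on_reflection_prod])
    (auto simp: nonconsecutive_subsets_def intro: finite_subset)

text \<open>Terms outside the alternation set vanish, and the remaining ones are indexed injectively
  by nonconsecutive sets.\<close>

lemma mult_q_highest_root:
  assumes I: "I \<subseteq> {1..N}"
  shows "mult_q N (highest_root N) (root_sum I) =
    (\<Sum>A\<in>nonconsecutive_subsets ({2..<N} - I).
       (-1) ^ card A * kostant_q N (root_sum ({1..N} - I - A)))"
proof -
  let ?f = "\<lambda>\<sigma>. (-1) ^ weyl_length N \<sigma> *
        kostant_q N (weyl_act \<sigma> (highest_root N + half_sum N) - half_sum N - root_sum I)"
  have "mult_q N (highest_root N) (root_sum I) =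
      sum ?f (alternation_set N (highest_root N) (root_sum I))"
    unfolding mult_q_def
  proof (rule sum.mono_neutral_right)
    show "finite (weyl_group N)" by (simp add: weyl_group_def finite_permutations)
    show "alternation_set N (highest_root N) (root_sum I) \<subseteq> weyl_group N"
      by (auto simp: alternation_set_def)
    show "\<forall>\<sigma>\<in>weyl_group N - alternation_set N (highest_root N) (root_sum I). ?f \<sigma> = 0"
      by (auto simp: alternation_set_def kostant_q_eq_0 simp del: plus_fun_apply)
  qed
  also have "\<dots> = (\<Sum>A\<in>nonconsecutive_subsets ({2..<N} - I). ?f (reflection_prod A))"
    by (simp add: alternation_set_highest_root[OF I] sum.reindex inj_on_reflection_prod_subsets
        del: plus_fun_apply)
  also have "\<dots> = (\<Sum>A\<in>nonconsecutive_subsets ({2..<N} - I).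
       (-1) ^ card A * kostant_q N (root_sum ({1..N} - I - A)))"
  proof (rule sum.cong)
    fix A assume "A \<in> nonconsecutive_subsets ({2..<N} - I)"
    then have A: "A \<subseteq> {2..<N} - I" "nonconsecutive A" by (auto simp: nonconsecutive_subsets_def)
    then have "A \<subseteq> {1..N}" by auto
    then show "?f (reflection_prod A) = (-1) ^ card A * kostant_q N (root_sum ({1..N} - I - A))"
      unfolding weyl_act_reflection_prod_root_sum[OF I A]
      by (simp add: minus_one_power_weyl_length_reflection_prod)
  qed simp
  finally show ?thesis .
qed

section \<open>Gaps of I as problems of smaller rank\<close>

text \<open>Injectivity of \<open>reflection_prod\<close> turns membership of the product into a
  condition on the index set. Since \<open>J\<close> avoids \<open>I\<close>, all that remains is to
  avoid the end nodes 1 and r.\<close>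

lemma admissible_sets_eq:
  assumes "I \<subseteq> {1..r}" "J \<subseteq> {1..r}" "J \<inter> I = {}"
  shows "admissible_sets r I J = nonconsecutive_subsets (J \<inter> {2..<r})"
proof -
  have "A \<in> admissible_sets r I J \<longleftrightarrow> A \<in> nonconsecutive_subsets (J \<inter> {2..<r})" for A
  proof (cases "A \<subseteq> J \<and> nonconsecutive A")
    case True
    then have "finite A" using assms(2) by (meson finite_atLeastAtMost finite_subset)
    then have "reflection_prod A \<in> reflection_prod ` nonconsecutive_subsets ({2..<r} - I) \<longleftrightarrow>
        A \<in> nonconsecutive_subsets ({2..<r} - I)"
      using True by (intro inj_on_image_mem_iff[OF inj_on_reflection_prod])
        (auto simp: nonconsecutive_subsets_def intro: finite_subset)
    with True assms show ?thesis
      by (auto simp: admissible_sets_def alternation_set_highest_root nonconsecutive_subsets_def)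
  qed (auto simp: admissible_sets_def nonconsecutive_subsets_def)
  then show ?thesis by blast
qed

lemma nonconsecutive_subsets_shift:
  "nonconsecutive_subsets ((\<lambda>b. b + d) ` X) = (`) (\<lambda>b. b + d) ` nonconsecutive_subsets X"
proof -
  have "nonconsecutive ((\<lambda>b. b + d) ` A) \<longleftrightarrow> nonconsecutive A" for A
    by (auto simp: nonconsecutive_def)
  then show ?thesis
    by (auto simp: nonconsecutive_subsets_def subset_image_iff image_iff)
qed

text \<open>Common form of the three cases: the complement of \<open>I'\<close> in rank
  \<open>N\<close>, translated by \<open>d\<close>, is the gap. \<open>J\<close> matches the simple
  roots to be partitioned and \<open>J2\<close> the usable reflections; these differ when the gap
  contains an end node of the diagram.\<close>

lemma gap_sum_eq_mult_q:
  assumes I: "I \<subseteq> {1..r}" and gap: "{a..b} \<subseteq> {1..r}" "{a..b} \<inter> I = {}"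
    and I': "I' \<subseteq> {1..N}" and le: "N + d \<le> r"
    and J: "{a..b} = (\<lambda>b. b + d) ` ({1..N} - I')"
    and J2: "{a..b} \<inter> {2..<r} = (\<lambda>b. b + d) ` ({2..<N} - I')"
  shows "(\<Sum>A\<in>admissible_sets r I {a..b}.
      (-1) ^ weyl_length r (reflection_prod A) * kostant_q r (root_seg a b - (\<Sum>a\<in>A. simple_root a)))
    = mult_q N (highest_root N) (root_sum I')"
proof -
  let ?s = "\<lambda>b. b + d"
  let ?X = "{2..<N} - I'"
  let ?f = "\<lambda>A. (-1) ^ weyl_length r (reflection_prod A) *
    kostant_q r (root_seg a b - (\<Sum>a\<in>A. simple_root a))"
  have "admissible_sets r I {a..b} = (`) ?s ` nonconsecutive_subsets ?X"
    by (simp only: admissible_sets_eq[OF I gap] J2 nonconsecutive_subsets_shift)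
  moreover have "inj_on ((`) ?s) (nonconsecutive_subsets ?X)"
    by (auto intro!: inj_onI simp: inj_image_eq_iff)
  ultimately have "sum ?f (admissible_sets r I {a..b}) = (\<Sum>A\<in>nonconsecutive_subsets ?X. ?f (?s ` A))"
    by (simp add: sum.reindex)
  also have "\<dots> = (\<Sum>A\<in>nonconsecutive_subsets ?X.
       (-1) ^ card A * kostant_q N (root_sum ({1..N} - I' - A)))"
  proof (rule sum.cong)
    fix A assume "A \<in> nonconsecutive_subsets ?X"
    then have A: "A \<subseteq> ?X" by (auto simp: nonconsecutive_subsets_def)
    then have sA: "?s ` A \<subseteq> {a..b}" unfolding J by auto
    have "root_seg a b - (\<Sum>a\<in>?s ` A. simple_root a) = root_sum ({a..b} - ?s ` A)"
      using root_sum_Diff[OF _ sA] by (simp add: root_seg_eq_root_sum root_sum_def)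
    also have "{a..b} - ?s ` A = ?s ` ({1..N} - I' - A)"
      unfolding J by (rule image_set_diff[symmetric]) (auto intro: injI)
    finally have "kostant_q r (root_seg a b - (\<Sum>a\<in>?s ` A. simple_root a)) =
        kostant_q N (root_sum ({1..N} - I' - A))"
      using kostant_q_shift[OF _ le, of "{1..N} - I' - A"] by (simp only:) blast
    moreover have "?s ` A \<subseteq> {1..r}" using sA gap by blast
    moreover have "card (?s ` A) = card A" by (intro card_image) (auto intro: inj_onI)
    ultimately show "?f (?s ` A) = (-1) ^ card A * kostant_q N (root_sum ({1..N} - I' - A))"
      by (simp add: minus_one_power_weyl_length_reflection_prod)
  qed simp
  also have "\<dots> = mult_q N (highest_root N) (root_sum I')"
    using mult_q_highest_root[OF I'] by simp
  finally show ?thesis .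
qed

lemma interval_partition_mono:
  assumes "interval_partition I n i j" "1 \<le> x" "x \<le> y" "y \<le> n"
  shows "i x \<le> i y \<and> j x \<le> j y"
  using assms(3,4)
proof (induction y rule: dec_induct)
  case (step y)
  then have "i y \<le> j y" "j y + 1 < i (y + 1)" "i (y + 1) \<le> j (y + 1)"
    using assms(1,2) by (auto simp: interval_partition_def)
  with step show ?case by auto
qed simp

theorem theorem4p2:
  fixes r n :: nat and I :: "nat set" and i j :: "nat \<Rightarrow> nat"
  assumes "r \<ge> 1"
    and "I \<subseteq> {1..r}"
    and "I \<noteq> {}"
    and "interval_partition I n i j"
  shows
    "(1 \<notin> I \<longrightarrow>
        (\<Sum>A\<in>admissible_sets r I {1..i 1 - 1}.
           (-1) ^ weyl_length r (reflection_prod A) *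
           kostant_q r (root_seg 1 (i 1 - 1) - (\<Sum>a\<in>A. simple_root a)))
        = mult_q (i 1) (highest_root (i 1)) (simple_root (i 1))) \<and>
     (\<forall>x\<in>{1..n - 1}. let N = i (x + 1) - j x + 1 in
        (\<Sum>A\<in>admissible_sets r I {j x + 1..i (x + 1) - 1}.
           (-1) ^ weyl_length r (reflection_prod A) *
           kostant_q r (root_seg (j x + 1) (i (x + 1) - 1) - (\<Sum>a\<in>A. simple_root a)))
        = mult_q N (highest_root N) (simple_root 1 + simple_root N)) \<and>
     (r \<notin> I \<longrightarrow> (let N = r - j n + 1 in
        (\<Sum>A\<in>admissible_sets r I {j n + 1..r}.
           (-1) ^ weyl_length r (reflection_prod A) *
           kostant_q r (root_seg (j n + 1) r - (\<Sum>a\<in>A. simple_root a)))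
        = mult_q N (highest_root N) (simple_root 1)))"
proof -
  note part = assms(4)
  have "1 \<le> n" using assms(3) part by (cases n) (auto simp: interval_partition_def)
  have endpoints: "i x \<in> I" "j x \<in> I" if "x \<in> {1..n}" for x
    using that part unfolding interval_partition_def by force+
  have mem: "\<exists>x\<in>{1..n}. m \<in> {i x..j x}" if "m \<in> I" for m
    using that part by (auto simp: interval_partition_def)
  note mono = interval_partition_mono[OF part]
  have first: "(\<Sum>A\<in>admissible_sets r I {1..i 1 - 1}.
           (-1) ^ weyl_length r (reflection_prod A) *
           kostant_q r (root_seg 1 (i 1 - 1) - (\<Sum>a\<in>A. simple_root a)))
        = mult_q (i 1) (highest_root (i 1)) (simple_root (i 1))" if "1 \<notin> I"
  proof -
    have "i 1 \<in> I" using \<open>1 \<le> n\<close> by (intro endpoints) auto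
    then have i1: "i 1 \<in> {2..r}" using that assms(2) by (cases "i 1 = 1") force+
    have disj: "{1..i 1 - 1} \<inter> I = {}"
    proof -
      have "i 1 \<le> m" if "m \<in> I" for m
        using mem[OF that] mono[of 1] by fastforce
      then show ?thesis using i1 by fastforce
    qed
    have "(\<Sum>A\<in>admissible_sets r I {1..i 1 - 1}.
           (-1) ^ weyl_length r (reflection_prod A) *
           kostant_q r (root_seg 1 (i 1 - 1) - (\<Sum>a\<in>A. simple_root a)))
        = mult_q (i 1) (highest_root (i 1)) (root_sum {i 1})"
      by (rule gap_sum_eq_mult_q[OF assms(2) _ disj, where d = 0]) (use i1 in auto)
    then show ?thesis by (simp add: root_sum_def)
  qed
  have middle: "(\<Sum>A\<in>admissible_sets r I {j x + 1..i (x + 1) - 1}.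
           (-1) ^ weyl_length r (reflection_prod A) *
           kostant_q r (root_seg (j x + 1) (i (x + 1) - 1) - (\<Sum>a\<in>A. simple_root a)))
        = mult_q N (highest_root N) (simple_root 1 + simple_root N)"
    if x: "x \<in> {1..n - 1}" and N: "N = i (x + 1) - j x + 1" for x N
  proof -
    have "j x \<in> I" "i (x + 1) \<in> I" using x by (auto intro!: endpoints)
    then have ij: "1 \<le> j x" "i (x + 1) \<le> r" using assms(2) by auto
    have lt: "j x + 1 < i (x + 1)" using x part by (auto simp: interval_partition_def)
    have disj: "{j x + 1..i (x + 1) - 1} \<inter> I = {}"
    proof -
      have "m \<le> j x \<or> i (x + 1) \<le> m" if m: "m \<in> I" for m
      proof -
        obtain y where y: "y \<in> {1..n}" "m \<in> {i y..j y}" using mem[OF m] by blast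
        show ?thesis
        proof (cases "y \<le> x")
          case True
          then show ?thesis using mono[of y x] x y by fastforce
        next
          case False
          then show ?thesis using mono[of "x + 1" y] x y by fastforce
        qed
      qed
      then show ?thesis by fastforce
    qed
    \<comment> \<open>Translation by j_x - 1 sends 1 to j_x and N to i_{x+1}, the two elements of I
      around the gap, so every node of the gap is usable.\<close>
    have img: "(\<lambda>b. b + (j x - 1)) ` {2..<N} = {j x + 1..i (x + 1) - 1}"
      using ij lt N by (simp only: image_add_atLeastLessThan') auto
    have X: "{1..N} - {1, N} = {2..<N}" "{2..<N} - {1, N} = {2..<N}" by auto
    have "(\<Sum>A\<in>admissible_sets r I {j x + 1..i (x + 1) - 1}.
           (-1) ^ weyl_length r (reflection_prod A) *
           kostant_q r (root_seg (j x + 1) (i (x + 1) - 1) - (\<Sum>a\<in>A. simple_root a)))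
        = mult_q N (highest_root N) (root_sum {1, N})"
      by (rule gap_sum_eq_mult_q[OF assms(2) _ disj, where d = "j x - 1"], unfold X img)
        (use ij lt N in auto)
    \<comment> \<open>The gap is nonempty, so N \<ge> 3 and \<open>{1, N}\<close> has two distinct
      elements.\<close>
    then show ?thesis using N lt by (simp add: root_sum_def)
  qed
  have last: "(\<Sum>A\<in>admissible_sets r I {j n + 1..r}.
           (-1) ^ weyl_length r (reflection_prod A) *
           kostant_q r (root_seg (j n + 1) r - (\<Sum>a\<in>A. simple_root a)))
        = mult_q N (highest_root N) (simple_root 1)" if "r \<notin> I" and N: "N = r - j n + 1" for N
  proof -
    have "j n \<in> I" using \<open>1 \<le> n\<close> by (intro endpoints) auto
    then have jn: "1 \<le> j n" "j n < r" using that(1) assms(2) by (auto simp: order.strict_iff_order)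
    have disj: "{j n + 1..r} \<inter> I = {}"
    proof -
      have "m \<le> j n" if "m \<in> I" for m
        using mem[OF that] mono[of _ n] by fastforce
      then show ?thesis by fastforce
    qed
    \<comment> \<open>Here 1 goes to j_n and N to r. Node r lies in the gap but is not usable, hence
      the separate images of \<open>{2..N}\<close> and \<open>{2..<N}\<close>.\<close>
    have img: "(\<lambda>b. b + (j n - 1)) ` {2..N} = {j n + 1..r}"
        "(\<lambda>b. b + (j n - 1)) ` {2..<N} = {j n + 1..<r}"
      using jn N by (simp_all only: image_add_atLeastLessThan' image_add_atLeastAtMost') auto
    have X: "{1..N} - {1} = {2..N}" "{2..<N} - {1} = {2..<N}" by auto
    have "(\<Sum>A\<in>admissible_sets r I {j n + 1..r}.
           (-1) ^ weyl_length r (reflection_prod A) *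
           kostant_q r (root_seg (j n + 1) r - (\<Sum>a\<in>A. simple_root a)))
        = mult_q N (highest_root N) (root_sum {1})"
      by (rule gap_sum_eq_mult_q[OF assms(2) _ disj, where d = "j n - 1"], unfold X img)
        (use jn N in auto)
    then show ?thesis by (simp add: root_sum_def)
  qed
  show ?thesis
    unfolding Let_def using first middle last by blast
qed

end
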